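(* Let $\mathbf{s}=(s_1,\dots,s_r)\in\mathbb{Z}^r$ and $\boldsymbol{\epsilon}=(\epsilon_1,\dots,\epsilon_r)\in\{\pm1\}^r$. Then for every integer $n\geq 1$, \[ C_n^{\mathbf{s};\boldsymbol{\epsilon}}=(-1)^n \sum_{n+1\geq m_1>\cdots>m_r>0} \frac{\epsilon_1^{m_1}\cdots\epsilon_r^{m_r}(-1)^{m_1-1}(m_1-1)!\left\{\begin{array}{c} n+1\\ m_1\end{array}\right\}}{m_1^{s_1}\cdots m_r^{s_r}}. \]
   Context: For $\mathbf{s}=(s_1,\dots,s_r)\in\mathbb{Z}^r$, $\mathrm{Li}_{\mathbf{s}}(z_1,\dots,z_r)=\sum_{n_1>\cdots>n_r\geq1}\frac{z_1^{n_1}\cdots z_r^{n_r}}{n_1^{s_1}\cdots n_r^{s_r}}$. For $\boldsymbol{\epsilon}\in\{\pm1\}^r$, the rationals $C_n^{\mathbf{s};\boldsymbol{\epsilon}}$ are defined by $\sum_{n\geq0}C_n^{\mathbf{s};\boldsymbol{\epsilon}}\frac{x^n}{n!}=e^{-x}\frac{\mathrm{Li}_{\mathbf{s}}((1-e^{-x})\epsilon_1,\epsilon_2,\dots,\epsilon_r)}{1-e^{-x}}$. The Stirling numbers of the second kind $\left\{\begin{array}{c} n\\ m\end{array}\right\}$ are defined by $(e^x-1)^m=m!\sum_{n\geq m}\left\{\begin{array}{c} n\\ m\end{array}\right\}\frac{x^n}{n!}$. *)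

theory Defs
  imports "HOL-Analysis.Infinite_Sum"
    "HOL-Computational_Algebra.Formal_Power_Series"
    "HOL-Combinatorics.Stirling"
begin

unbundle fps_syntax

text \<open>
  Tuples are lists indexed from 0, so the paper's \<open>s\<^sub>1, \<dots>, s\<^sub>r\<close> is \<open>s ! 0, \<dots>, s ! (r - 1)\<close>.
\<close>

definition dec_tuples :: "nat \<Rightarrow> nat list set" where
  "dec_tuples r = {ns. length ns = r \<and> sorted_wrt (>) ns \<and> (\<forall>n\<in>set ns. n \<ge> 1)}"

text \<open>
  The arguments may be complex numbers, in which case this is the numerical multiple
  polylogarithm, or formal power series over a field, in which case the infinite sum is
  taken in the X-adic topology of the library.
\<close>

definition Li :: "int list \<Rightarrow> 'a list \<Rightarrow> 'a::{comm_semiring_1, inverse, t2_space}" where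
  "Li s z = (\<Sum>\<^sub>\<infinity>ns\<in>dec_tuples (length s).
     (\<Prod>i<length s. z ! i ^ (ns ! i)) / (\<Prod>i<length s. of_nat (ns ! i) powi (s ! i)))"

definition Li_args :: "int list \<Rightarrow> rat fps list" where
  "Li_args eps = ((1 - fps_exp (-1)) * of_int (hd eps)) # map of_int (tl eps)"

text \<open>
  Both \<open>Li s (Li_args eps)\<close> and \<open>1 - fps_exp (-1)\<close> have zero constant coefficient; the
  division below is the one of the library, which cancels the common factor \<open>X\<close>. See
  \<open>Li_summable\<close> and \<open>Li_quotient_exact\<close>.
\<close>

definition multi_poly_Bernoulli_C :: "int list \<Rightarrow> int list \<Rightarrow> nat \<Rightarrow> rat" where
  "multi_poly_Bernoulli_C s eps n =
     fact n * fps_nth (fps_exp (-1) * (Li s (Li_args eps) / (1 - fps_exp (-1)))) n"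

lemma multi_poly_Bernoulli_C_egf:
  "Abs_fps (\<lambda>n. multi_poly_Bernoulli_C s eps n / fact n) =
     fps_exp (-1) * (Li s (Li_args eps) / (1 - fps_exp (-1)))"
  by (simp add: fps_eq_iff multi_poly_Bernoulli_C_def)

text \<open>The library's \<open>Stirling\<close> is defined by the usual recurrence.\<close>

lemma Stirling_egf:
  "(fps_exp 1 - 1 :: 'a::field_char_0 fps) ^ m =
     of_nat (fact m) * Abs_fps (\<lambda>n. of_nat (Stirling n m) / fact n)"
proof (induction m)
  case 0
  show ?case
  proof (rule fps_ext)
    fix n show "((fps_exp 1 - 1 :: 'a fps) ^ 0) $ n =
       (of_nat (fact 0) * Abs_fps (\<lambda>n. of_nat (Stirling n 0) / fact n)) $ n"
      by (cases n) auto
  qed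
next
  case (Suc m)
  note IHm = Suc.IH
  let ?E = "fps_exp 1 - 1 :: 'a fps"
  have d: "fps_deriv (?E ^ Suc m) = of_nat (Suc m) * (?E ^ Suc m + ?E ^ m)"
  proof -
    have "fps_deriv (?E ^ Suc m) = of_nat (Suc m) * fps_exp 1 * ?E ^ m"
      unfolding fps_deriv_power' by simp
    also have "\<dots> = of_nat (Suc m) * (?E ^ Suc m + ?E ^ m)"
      unfolding power_Suc by (simp only: algebra_simps) simp
    finally show ?thesis .
  qed
  have nth: "(?E ^ Suc m) $ n = of_nat (fact (Suc m)) * of_nat (Stirling n (Suc m)) / fact n" for n
  proof (induction n)
    case 0
    then show ?case by simp
  next
    case (Suc n)
    have "of_nat (Suc n) * (?E ^ Suc m) $ Suc n = fps_deriv (?E ^ Suc m) $ n"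
      by (simp only: fps_deriv_nth Suc_eq_plus1)
    also have "\<dots> = of_nat (Suc m) * ((?E ^ Suc m) $ n + (?E ^ m) $ n)"
      unfolding d by (simp only: fps_of_nat[symmetric] fps_mult_left_const_nth fps_add_nth)
    also have "(?E ^ m) $ n = of_nat (fact m) * of_nat (Stirling n m) / fact n"
      unfolding IHm
      by (simp only: fps_of_nat[symmetric] fps_mult_left_const_nth fps_nth_Abs_fps times_divide_eq_right)
    finally have eq: "of_nat (Suc n) * (?E ^ Suc m) $ Suc n = of_nat (Suc m) *
       (of_nat (fact (Suc m)) * of_nat (Stirling n (Suc m)) / fact n
         + of_nat (fact m) * of_nat (Stirling n m) / fact n)"
      unfolding Suc.IH .
    have "of_nat (Suc n) * (?E ^ Suc m) $ Suc n =
       of_nat (Suc n) * (of_nat (fact (Suc m)) * of_nat (Stirling (Suc n) (Suc m)) / fact (Suc n))"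
      unfolding eq
      by (simp add: add_divide_distrib distrib_left distrib_right mult_ac del: of_nat_Suc)
        (simp add: add_divide_distrib distrib_left distrib_right mult_ac)
    then show ?case by (simp only: mult_cancel_left of_nat_eq_0_iff) simp
  qed
  show ?case
    by (rule fps_ext, unfold nth)
       (simp only: fps_of_nat[symmetric] fps_mult_left_const_nth fps_nth_Abs_fps times_divide_eq_right)
qed

lemma finite_dec_tuples_le: "finite {ns \<in> dec_tuples r. ns ! 0 \<le> k}"
proof (rule finite_subset)
  show "{ns \<in> dec_tuples r. ns ! 0 \<le> k} \<subseteq> {ns. set ns \<subseteq> {..k} \<and> length ns = r}"
  proof (clarsimp simp: dec_tuples_def)
    fix ns x assume ns: "sorted_wrt (>) ns" "ns ! 0 \<le> k" "x \<in> set ns"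
    then obtain i where i: "i < length ns" "x = ns ! i" by (auto simp: in_set_conv_nth)
    then have "x \<le> ns ! 0"
      using sorted_wrt_nth_less[OF ns(1), of 0 i] by (cases "i = 0") auto
    with ns show "x \<le> k" by simp
  qed
qed (rule finite_lists_length_eq, simp)

lemma Li_summand:
  fixes z :: "'a::field_char_0 fps list"
  shows "(\<Prod>i<length s. z ! i ^ (ns ! i)) / (\<Prod>i<length s. of_nat (ns ! i) powi (s ! i)) =
     fps_const (inverse (\<Prod>i<length s. of_nat (ns ! i) powi (s ! i))) * (\<Prod>i<length s. z ! i ^ (ns ! i))"
  (is "_ = fps_const (inverse ?d) * _")
proof -
  have "(of_nat m :: 'a fps) powi k = fps_const (of_nat m powi k)" for m k
    by (simp add: power_int_def fps_const_inverse flip: fps_of_nat)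
  moreover have "(\<Prod>i<l. fps_const (f i)) = fps_const (prod f {..<l})" for f :: "nat \<Rightarrow> 'a" and l
    by (induction l) simp_all
  ultimately have "(\<Prod>i<length s. (of_nat (ns ! i) :: 'a fps) powi (s ! i)) = fps_const ?d"
    by simp
  then show ?thesis
    by (simp add: fps_divide_unit' fps_const_inverse mult.commute)
qed

lemma Li_has_sum:
  fixes z :: "'a::field_char_0 fps list"
  assumes "s \<noteq> []" and "fps_nth (z ! 0) 0 = 0"
  shows "((\<lambda>ns. (\<Prod>i<length s. z ! i ^ (ns ! i)) / (\<Prod>i<length s. of_nat (ns ! i) powi (s ! i)))
     has_sum Abs_fps (\<lambda>k. \<Sum>ns\<in>{ns\<in>dec_tuples (length s). ns ! 0 \<le> k}.
       fps_nth (\<Prod>i<length s. z ! i ^ (ns ! i)) k / (\<Prod>i<length s. of_nat (ns ! i) powi (s ! i))))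
     (dec_tuples (length s))"
  (is "(?f has_sum Abs_fps (\<lambda>k. sum (?g k) (?B k))) ?A")
proof -
  have nth: "?f ns $ k = ?g k ns" for ns k
    unfolding Li_summand by (simp add: divide_inverse mult.commute)
  have zero: "?f ns $ k = 0" if "ns \<in> ?A - ?B k" for ns k
  proof -
    from that have "k < ns ! 0" by auto
    obtain l where l: "length s = Suc l" using assms by (cases s) auto
    have "\<exists>w. z ! 0 = fps_X * w"
    proof
      show "z ! 0 = fps_X * fps_shift 1 (z ! 0)"
        by (rule fps_ext) (simp add: assms(2))
    qed
    then obtain w where w: "z ! 0 = fps_X * w" ..
    have "(\<Prod>i<length s. z ! i ^ (ns ! i)) =
        fps_X ^ (ns ! 0) * (w ^ (ns ! 0) * (\<Prod>i<l. z ! Suc i ^ (ns ! Suc i)))"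
      unfolding l prod.lessThan_Suc_shift by (simp add: w power_mult_distrib mult.assoc)
    then show ?thesis
      unfolding nth using \<open>k < ns ! 0\<close> by (simp add: fps_X_power_mult_nth)
  qed
  show ?thesis
    unfolding has_sum_def
  proof (rule tendsto_fpsI)
    fix k
    show "\<forall>\<^sub>F F in finite_subsets_at_top ?A. sum ?f F $ k = Abs_fps (\<lambda>k. sum (?g k) (?B k)) $ k"
      unfolding eventually_finite_subsets_at_top
    proof (intro exI[of _ "?B k"] conjI allI impI)
      fix F assume F: "finite F \<and> ?B k \<subseteq> F \<and> F \<subseteq> ?A"
      have "sum ?f F $ k = (\<Sum>ns\<in>F. ?f ns $ k)" by (rule fps_sum_nth)
      also have "\<dots> = (\<Sum>ns\<in>?B k. ?f ns $ k)"
        using F zero by (intro sum.mono_neutral_right) auto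
      finally show "sum ?f F $ k = Abs_fps (\<lambda>k. sum (?g k) (?B k)) $ k"
        by (simp add: nth)
    qed (auto intro: finite_dec_tuples_le)
  qed
qed

lemma
  assumes "s \<noteq> []"
  shows Li_summable:
      "(\<lambda>ns. (\<Prod>i<length s. Li_args eps ! i ^ (ns ! i)) / (\<Prod>i<length s. of_nat (ns ! i) powi (s ! i)))
         summable_on dec_tuples (length s)"
    and Li_quotient_exact:
      "(1 - fps_exp (-1)) * (Li s (Li_args eps) / (1 - fps_exp (-1))) = Li s (Li_args eps)"
proof -
  have z0: "Li_args eps ! 0 $ 0 = 0" by (simp add: Li_args_def)
  note hs = Li_has_sum[OF assms z0]
  show "(\<lambda>ns. (\<Prod>i<length s. Li_args eps ! i ^ (ns ! i)) / (\<Prod>i<length s. of_nat (ns ! i) powi (s ! i)))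
         summable_on dec_tuples (length s)"
    using hs by (rule has_sum_imp_summable)
  have "{ns \<in> dec_tuples (length s). ns ! 0 \<le> 0} = {}"
  proof (intro equals0I)
    fix ns assume "ns \<in> {ns \<in> dec_tuples (length s). ns ! 0 \<le> 0}"
    then have ns: "length ns = length s" "ns ! 0 = 0" "\<forall>n\<in>set ns. n \<ge> 1"
      by (auto simp: dec_tuples_def)
    moreover have "ns ! 0 \<in> set ns"
      using ns(1) assms by (intro nth_mem) simp
    ultimately
    show False by force
  qed
  then have 0: "Li s (Li_args eps) $ 0 = 0"
    unfolding Li_def infsumI[OF hs] fps_nth_Abs_fps by (simp only: sum.empty)
  let ?u = "1 - fps_exp (-1) :: rat fps"
  have sub: "subdegree ?u = 1" by (rule subdegreeI) auto
  then have u: "?u \<noteq> 0" by (metis subdegree_0 zero_neq_one)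
  have "?u dvd Li s (Li_args eps)"
  proof (cases "Li s (Li_args eps) = 0")
    case False
    then have "subdegree (Li s (Li_args eps)) \<noteq> 0"
      using 0 by (simp add: subdegree_eq_0_iff)
    then show ?thesis using False u sub by (simp add: fps_dvd_iff)
  qed simp
  then show "?u * (Li s (Li_args eps) / ?u) = Li s (Li_args eps)"
    by (rule dvd_mult_div_cancel)
qed

end

theory Submission
  imports Defs
begin

text \<open>
  Put \<open>u = 1 - exp (-X)\<close>, so that \<open>u' = exp (-X)\<close>. Dividing the series for \<open>Li\<close> by \<open>u\<close> termwise, the
  generating function is a sum of multiples of \<open>exp (-X) * u ^ (m - 1) = (u ^ m)' / m\<close> with
  \<open>m = m\<^sub>1\<close>, and the coefficients of \<open>u ^ m\<close> are, up to sign, those of \<open>(exp X - 1) ^ m\<close>.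
\<close>

text \<open>Substituting \<open>-X\<close> for \<open>X\<close> in \<open>exp X - 1\<close> gives
  \<open>-u\<close>. The substitution multiplies the coefficient of \<open>X ^ k\<close> by
  \<open>(-1) ^ k\<close>, and the outer sign contributes \<open>(-1) ^ m\<close>.\<close>

lemma fps_nth_one_minus_exp_neg_power:
  "((1 - fps_exp (-1) :: 'a::field_char_0 fps) ^ m) $ k =
     (-1) ^ m * (-1) ^ k * fact m * of_nat (Stirling k m) / fact k"
proof -
  let ?E = "fps_exp 1 - 1 :: 'a fps"
  let ?Y = "fps_const (-1) * fps_X :: 'a fps"
  have "1 - fps_exp (-1) = fps_const (-1) * (?E oo ?Y)"
    by (simp add: fps_compose_sub_distrib fps_exp_compose_linear flip: fps_const_neg)
  then have "(1 - fps_exp (-1) :: 'a fps) ^ m = fps_const ((-1) ^ m) * (?E ^ m oo ?Y)"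
    by (simp only: power_mult_distrib fps_const_power) (simp add: fps_compose_power)
  also have "\<dots> $ k = (-1) ^ m * ((-1) ^ k * (?E ^ m) $ k)"
    by (simp only: fps_mult_left_const_nth fps_compose_linear fps_nth_Abs_fps)
  also have "(?E ^ m) $ k = fact m * of_nat (Stirling k m) / fact k"
    unfolding Stirling_egf
    by (simp only: fps_of_nat[symmetric] fps_mult_left_const_nth fps_nth_Abs_fps) simp
  finally show ?thesis by simp
qed

lemma fps_nth_exp_neg_mult_power:
  assumes "m \<ge> 1"
  shows "fact n * (fps_exp (-1) * (1 - fps_exp (-1) :: 'a::field_char_0 fps) ^ (m - 1)) $ n =
     (-1) ^ n * ((-1) ^ (m - 1) * fact (m - 1) * of_nat (Stirling (n + 1) m))"
proof -
  obtain l where m: "m = Suc l" using assms by (cases m) auto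
  let ?u = "1 - fps_exp (-1) :: 'a fps"
  have "fps_deriv (?u ^ m) = of_nat m * (fps_exp (-1) * ?u ^ l)"
    unfolding fps_deriv_power' m by (simp flip: fps_const_neg)
  then have "of_nat (n + 1) * (?u ^ m) $ (n + 1) = of_nat m * (fps_exp (-1) * ?u ^ l) $ n"
    by (metis fps_deriv_nth fps_mult_left_const_nth fps_of_nat)
  then have "of_nat m * (fact n * (fps_exp (-1) * ?u ^ l) $ n) = fact (n + 1) * (?u ^ m) $ (n + 1)"
    by (simp add: mult_ac)
  \<comment> \<open>Here \<open>fact (n + 1)\<close> cancels, \<open>fact m\<close> splits as
    \<open>m * fact l\<close>, and the two extra signs from \<open>m = l + 1\<close> and from the
    index \<open>n + 1\<close> cancel each other.\<close>
  also have "\<dots> = of_nat m * ((-1) ^ n * ((-1) ^ l * fact l * of_nat (Stirling (n + 1) m)))"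
    unfolding fps_nth_one_minus_exp_neg_power m by (simp add: mult_ac del: of_nat_Suc Stirling.simps)
  finally show ?thesis
    using m by (simp del: of_nat_Suc Stirling.simps)
qed

text \<open>The truncated sums are the coefficients of the formal infinite sum of
  \<open>c x * u ^ (e x - 1)\<close>, since \<open>u ^ j\<close> has no terms below
  \<open>X ^ j\<close>. Multiplication by \<open>a\<close> can thus be done termwise with finite
  sums only. It is applied with \<open>a = u\<close> to identify a quotient and with
  \<open>a = exp (-X)\<close> to read off the result.\<close>

lemma fps_mult_nth_truncated_sum:
  fixes u a :: "'a::field fps"
  assumes "fps_nth u 0 = 0" and "\<And>k. finite {x \<in> A. e x \<le> k}"
  shows "(a * Abs_fps (\<lambda>k. \<Sum>x | x \<in> A \<and> e x \<le> Suc k. c x * fps_nth (u ^ (e x - 1)) k)) $ n =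
     (\<Sum>x | x \<in> A \<and> e x \<le> Suc n. c x * (a * u ^ (e x - 1)) $ n)"
proof -
  let ?B = "\<lambda>k. {x \<in> A. e x \<le> Suc k}"
  \<comment> \<open>Raising the bound from \<open>k\<close> to \<open>n\<close> adds only terms that
    vanish at \<open>X ^ k\<close>. All coefficients in the Cauchy product then share one index set,
    so the two sums can be swapped.\<close>
  have extend: "(\<Sum>x\<in>?B k. c x * (u ^ (e x - 1)) $ k) = (\<Sum>x\<in>?B n. c x * (u ^ (e x - 1)) $ k)"
    if "k \<le> n" for k
  proof (intro sum.mono_neutral_left ballI)
    fix x assume "x \<in> ?B n - ?B k"
    then have "k < e x - 1" by auto
    then show "c x * (u ^ (e x - 1)) $ k = 0"
      using startsby_zero_power_prefix[OF assms(1)] by simp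
  qed (use that assms(2) in auto)
  have "(a * Abs_fps (\<lambda>k. \<Sum>x\<in>?B k. c x * (u ^ (e x - 1)) $ k)) $ n =
      (\<Sum>i=0..n. \<Sum>x\<in>?B n. c x * (a $ i * (u ^ (e x - 1)) $ (n - i)))"
    unfolding fps_mult_nth fps_nth_Abs_fps
    by (subst extend) (simp_all add: sum_distrib_left mult.left_commute)
  also have "\<dots> = (\<Sum>x\<in>?B n. c x * (a * u ^ (e x - 1)) $ n)"
    by (subst sum.swap) (simp add: fps_mult_nth sum_distrib_left)
  finally show ?thesis .
qed

text \<open>Only the first argument depends on \<open>X\<close>; its sign and all later arguments
  are constants and can be pulled out.\<close>

lemma prod_Li_args_power:
  assumes "eps \<noteq> []"
  shows "(\<Prod>i<length eps. Li_args eps ! i ^ (ms ! i)) =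
    fps_const (\<Prod>i<length eps. of_int (eps ! i) ^ (ms ! i)) * (1 - fps_exp (-1)) ^ (ms ! 0)"
proof -
  obtain e es where eps: "eps = e # es" using assms by (cases eps) auto
  have const: "(\<Prod>i<l. fps_const (f i)) = fps_const (prod f {..<l})" for f :: "nat \<Rightarrow> rat" and l
    by (induction l) simp_all
  have "(\<Prod>i<length es. map of_int es ! i ^ (ms ! Suc i)) =
      fps_const (\<Prod>i<length es. (of_int (es ! i) :: rat) ^ (ms ! Suc i))"
    by (simp add: const[symmetric] fps_const_power flip: fps_of_int)
  then show ?thesis
    by (simp add: eps Li_args_def prod.lessThan_Suc_shift power_mult_distrib
        fps_const_power mult_ac flip: fps_of_int fps_const_mult del: prod.lessThan_Suc)
qed

lemma nth_0_dec_tuples_ge_1: "ms \<in> dec_tuples r \<Longrightarrow> r \<ge> 1 \<Longrightarrow> ms ! 0 \<ge> 1"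
  by (cases ms) (auto simp: dec_tuples_def)

text \<open>The quotient is checked by multiplication: \<open>u\<close> times the claimed series is
  compared coefficientwise with the numerator, and the nonzero factor \<open>u\<close> is
  cancelled.\<close>

lemma Li_quotient_eq:
  assumes "s \<noteq> []" and "length eps = length s"
  defines "c \<equiv> \<lambda>ms. (\<Prod>i<length s. of_int (eps ! i) ^ (ms ! i)) /
      (\<Prod>i<length s. of_nat (ms ! i) powi (s ! i))"
  shows "Li s (Li_args eps) / (1 - fps_exp (-1)) =
    Abs_fps (\<lambda>k. \<Sum>ms | ms \<in> dec_tuples (length s) \<and> ms ! 0 \<le> Suc k.
      c ms * ((1 - fps_exp (-1)) ^ (ms ! 0 - 1)) $ k)"
  (is "?L / ?u = ?H")
proof -
  let ?A = "dec_tuples (length s)"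
  have u0: "?u $ 0 = 0" by simp
  have z0: "Li_args eps ! 0 $ 0 = 0" by (simp add: Li_args_def)
  have prod: "(\<Prod>i<length s. Li_args eps ! i ^ (ms ! i)) =
      fps_const (\<Prod>i<length s. of_int (eps ! i) ^ (ms ! i)) * ?u ^ (ms ! 0)" for ms
    using prod_Li_args_power[of eps ms] assms by fastforce
  have "(?u * ?H) $ k = ?L $ k" for k
  proof -
    have "(?u * ?H) $ k = (\<Sum>ms | ms \<in> ?A \<and> ms ! 0 \<le> Suc k. c ms * (?u * ?u ^ (ms ! 0 - 1)) $ k)"
      by (rule fps_mult_nth_truncated_sum[OF u0 finite_dec_tuples_le])
    also have "\<dots> = (\<Sum>ms | ms \<in> ?A \<and> ms ! 0 \<le> Suc k. c ms * (?u ^ (ms ! 0)) $ k)"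
    proof (intro sum.cong refl)
      fix ms assume "ms \<in> {ms. ms \<in> ?A \<and> ms ! 0 \<le> Suc k}"
      \<comment> \<open>This rules out truncation in the natural-number difference
        \<open>ms ! 0 - 1\<close>.\<close>
      then have "ms ! 0 \<ge> 1"
        using nth_0_dec_tuples_ge_1 assms by (cases s) auto
      then show "c ms * (?u * ?u ^ (ms ! 0 - 1)) $ k = c ms * (?u ^ (ms ! 0)) $ k"
        by (simp flip: power_Suc)
    qed
    \<comment> \<open>Tuples with leading entry \<open>k + 1\<close> drop out because
      \<open>u ^ (k + 1)\<close> has no term in \<open>X ^ k\<close>; the range now agrees with that
      of \<open>Li_has_sum\<close>.\<close>
    also have "\<dots> = (\<Sum>ms | ms \<in> ?A \<and> ms ! 0 \<le> k. c ms * (?u ^ (ms ! 0)) $ k)"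
    proof (intro sum.mono_neutral_right finite_dec_tuples_le ballI)
      fix ms assume "ms \<in> {ms. ms \<in> ?A \<and> ms ! 0 \<le> Suc k} - {ms. ms \<in> ?A \<and> ms ! 0 \<le> k}"
      then have "k < ms ! 0" by auto
      then show "c ms * (?u ^ (ms ! 0)) $ k = 0"
        using startsby_zero_power_prefix[OF u0] by simp
    qed auto
    also have "\<dots> = ?L $ k"
      unfolding Li_def infsumI[OF Li_has_sum[OF assms(1) z0]] fps_nth_Abs_fps
      unfolding prod fps_mult_left_const_nth c_def
      by (simp only: times_divide_eq_left)
    finally show ?thesis .
  qed
  then have "?L = ?u * ?H" by (simp add: fps_eq_iff)
  moreover have "?u $ 1 \<noteq> 0" by simp
  then have "?u \<noteq> 0" by (metis fps_zero_nth)
  ultimately show ?thesis by (simp only: nonzero_mult_div_cancel_left not_False_eq_True)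
qed

theorem theorem2p7:
  fixes s eps :: "int list" and r n :: nat
  assumes "r \<ge> 1"
    and "length s = r"
    and "length eps = r"
    and "set eps \<subseteq> {1, -1}"
    and "n \<ge> 1"
  shows "multi_poly_Bernoulli_C s eps n =
    (-1) ^ n * (\<Sum>ms | ms \<in> dec_tuples r \<and> ms ! 0 \<le> n + 1.
       ((\<Prod>i<r. of_int (eps ! i) ^ (ms ! i)) * (-1) ^ (ms ! 0 - 1) * fact (ms ! 0 - 1)
          * of_nat (Stirling (n + 1) (ms ! 0)))
       / (\<Prod>i<r. of_nat (ms ! i) powi (s ! i)))"
proof -
  define c :: "nat list \<Rightarrow> rat" where
    "c ms = (\<Prod>i<r. of_int (eps ! i) ^ (ms ! i)) / (\<Prod>i<r. of_nat (ms ! i) powi (s ! i))" for ms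
  let ?u = "1 - fps_exp (-1) :: rat fps"
  have "s \<noteq> []" "length eps = length s" using assms by auto
  note quot = Li_quotient_eq[OF this, unfolded assms(2), folded c_def]
  have u0: "?u $ 0 = 0" by simp
  \<comment> \<open>Absorbing \<open>exp (-X)\<close> into each power
    \<open>u ^ (ms ! 0 - 1)\<close> makes every summand a multiple of a derivative; the bound
    \<open>n + 1\<close> comes from the exponent being one less than the leading entry.\<close>
  have "multi_poly_Bernoulli_C s eps n = fact n *
      (\<Sum>ms | ms \<in> dec_tuples r \<and> ms ! 0 \<le> Suc n. c ms * (fps_exp (-1) * ?u ^ (ms ! 0 - 1)) $ n)"
    unfolding multi_poly_Bernoulli_C_def quot
    by (simp only: fps_mult_nth_truncated_sum[OF u0 finite_dec_tuples_le])
  also have "\<dots> = (\<Sum>ms | ms \<in> dec_tuples r \<and> ms ! 0 \<le> Suc n.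
      c ms * (fact n * (fps_exp (-1) * ?u ^ (ms ! 0 - 1)) $ n))"
    by (simp add: sum_distrib_left mult_ac)
  also have "\<dots> = (\<Sum>ms | ms \<in> dec_tuples r \<and> ms ! 0 \<le> Suc n.
      c ms * ((-1) ^ n * ((-1) ^ (ms ! 0 - 1) * fact (ms ! 0 - 1) * of_nat (Stirling (n + 1) (ms ! 0)))))"
    by (intro sum.cong refl arg_cong[where f = "(*) (c _)"] fps_nth_exp_neg_mult_power)
      (use nth_0_dec_tuples_ge_1 assms(1) in blast)
  finally show ?thesis
    by (simp add: c_def sum_distrib_left mult_ac del: Stirling.simps)
qed

end
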